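(* Let $a_{-2},a_{-1},a_1,a_2,c$ be indeterminates. For $n\ge0$ let $$F_n^{(+1)}(c)=\operatorname{perm}T_n(a_{-2},a_{-1},c,a_1,a_2),\qquad F_n^{(-1)}(c)=\det T_n(a_{-2},a_{-1},c,a_1,a_2).$$ Put $p=a_{-1}a_1$, $t=a_{-2}a_2$, $v=a_{-2}a_1^2+a_{-1}^2a_2$, and for $\varepsilon\in\{+1,-1\}$ let $$Q_\varepsilon(z)=1-(\varepsilon p+t)z^2-vz^3-t(\varepsilon p+t)z^4+t^3z^6,\quad Z_n^{(\varepsilon)}=F_n^{(\varepsilon)}(0),\quad Z^{(\varepsilon)}(z)=\sum_{n\ge0}Z_n^{(\varepsilon)}z^n.$$ Then for every $k,n\ge0$ and $\varepsilon\in\{+1,-1\}$, $$[c^k]F_n^{(\varepsilon)}(c)=[z^{n-k}](1+\varepsilon tz^2)^kZ^{(\varepsilon)}(z)^{k+1}.$$ Equivalently, $$[c^k]F_n^{(\varepsilon)}(c)=\sum_{j=0}^k\binom kj(\varepsilon t)^j\sum_{\substack{r_0+\cdots+r_k=n-k-2j\\ r_i\ge0}}Z_{r_0}^{(\varepsilon)}\cdots Z_{r_k}^{(\varepsilon)}.$$ For fixed $k$, $$\sum_{n\ge0}[c^k]F_n^{(\varepsilon)}(c)\,z^n=\frac{z^k(1-tz^2)^{k+1}(1+\varepsilon tz^2)^k}{Q_\varepsilon(z)^{k+1}}.$$ In $\mathbb Q(p,t,v)[z]$, $$\gcd\bigl(Q_\varepsilon(z),\,z(1-tz^2)(1+\varepsilon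 tz^2)\bigr)=1.$$ Hence, for either the determinant or the permanent, the generic minimal recurrence degree of the fixed-$k$ sequence $\bigl([c^k]F_n^{(\varepsilon)}(c)\bigr)_{n\ge0}$ is $6(k+1)$.
   Context: $T_n(a_{-2},a_{-1},c,a_1,a_2)$ is the $n\times n$ matrix whose $(i,j)$ entry is $a_{j-i}$ if $0<|j-i|\le2$, $c$ if $i=j$, and $0$ otherwise. $\operatorname{perm}$ is the permanent; determinant and permanent of the empty matrix are $1$. $[c^k]$ and $[z^k]$ denote coefficient extraction (zero for negative exponents). The minimal recurrence degree of $(u_n)_{n\ge0}$ is the least $d$ for which there are constants $c_1,\dots,c_d$ with $u_{n+d}+c_1u_{n+d-1}+\dots+c_du_n=0$ for all $n\ge0$; "generic" means for all parameter values $(a_{-2},a_{-1},a_1,a_2)$ in a nonempty Zariski-open subset of the parameter space. *)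

theory Defs
  imports
    "Jordan_Normal_Form.Determinant"
    "HOL-Computational_Algebra.Computational_Algebra"
    "HOL-Library.FuncSet"
begin

definition permanent :: "'a::comm_ring_1 mat \<Rightarrow> 'a" where
  "permanent A = (if dim_row A = dim_col A then
     (\<Sum>\<sigma> | \<sigma> permutes {0..<dim_row A}. \<Prod>i = 0..<dim_row A. A $$ (i, \<sigma> i)) else 0)"

definition penta_toeplitz :: "nat \<Rightarrow> 'a::zero \<Rightarrow> 'a \<Rightarrow> 'a \<Rightarrow> 'a \<Rightarrow> 'a \<Rightarrow> 'a mat" where
  "penta_toeplitz n am2 am1 c a1 a2 = mat n n (\<lambda>(i, j).
     let d = int j - int i in
     if d = -2 then am2 else if d = -1 then am1 else if d = 0 then c
     else if d = 1 then a1 else if d = 2 then a2 else 0)"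

text \<open>A tuple of parameters is always listed in the order
  \<open>(a\<^sub>-\<^sub>2, a\<^sub>-\<^sub>1, a\<^sub>1, a\<^sub>2)\<close>.\<close>

type_synonym 'a params = "'a \<times> 'a \<times> 'a \<times> 'a"

fun par_p :: "'a::comm_ring_1 params \<Rightarrow> 'a" where
  "par_p (am2, am1, a1, a2) = am1 * a1"

fun par_t :: "'a::comm_ring_1 params \<Rightarrow> 'a" where
  "par_t (am2, am1, a1, a2) = am2 * a2"

fun par_v :: "'a::comm_ring_1 params \<Rightarrow> 'a" where
  "par_v (am2, am1, a1, a2) = am2 * a1 ^ 2 + am1 ^ 2 * a2"

text \<open>The sign \<open>\<epsilon>\<close> is only meant to range over \<open>{1, -1}\<close>: \<open>1\<close> selects the
  permanent and \<open>-1\<close> the determinant. The diagonal entry \<open>c\<close> is the polynomial variable.\<close>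

fun F_poly :: "int \<Rightarrow> 'a::comm_ring_1 params \<Rightarrow> nat \<Rightarrow> 'a poly" where
  "F_poly \<epsilon> (am2, am1, a1, a2) n =
     (if \<epsilon> = 1 then permanent else det)
       (penta_toeplitz n [:am2:] [:am1:] [:0, 1:] [:a1:] [:a2:])"

definition Z_seq :: "int \<Rightarrow> 'a::comm_ring_1 params \<Rightarrow> nat \<Rightarrow> 'a" where
  "Z_seq \<epsilon> a n = poly (F_poly \<epsilon> a n) 0"

definition Z_fps :: "int \<Rightarrow> 'a::comm_ring_1 params \<Rightarrow> 'a fps" where
  "Z_fps \<epsilon> a = Abs_fps (Z_seq \<epsilon> a)"

definition Q_poly :: "int \<Rightarrow> 'a::comm_ring_1 params \<Rightarrow> 'a poly" where
  "Q_poly \<epsilon> a = (let p = par_p a; t = par_t a; v = par_v a; e = of_int \<epsilon> in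
     1 - monom (e * p + t) 2 - monom v 3 - monom (t * (e * p + t)) 4 + monom (t ^ 3) 6)"

text \<open>Coefficient extraction with an integer exponent, zero for negative exponents.\<close>

definition fps_coeff :: "'a::zero fps \<Rightarrow> int \<Rightarrow> 'a" where
  "fps_coeff f m = (if m < 0 then 0 else fps_nth f (nat m))"

definition satisfies_recurrence :: "(nat \<Rightarrow> 'a::comm_ring_1) \<Rightarrow> nat \<Rightarrow> bool" where
  "satisfies_recurrence u d \<longleftrightarrow>
     (\<exists>c :: nat \<Rightarrow> 'a. \<forall>n. u (n + d) + (\<Sum>i = 1..d. c i * u (n + d - i)) = 0)"

definition min_recurrence_degree :: "(nat \<Rightarrow> 'a::comm_ring_1) \<Rightarrow> nat \<Rightarrow> bool" where
  "min_recurrence_degree u d \<longleftrightarrow>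
     satisfies_recurrence u d \<and> (\<forall>d' < d. \<not> satisfies_recurrence u d')"

text \<open>Polynomials in four variables are iterated univariate polynomials; the first variable
  is the innermost one.\<close>

fun eval4 :: "'a::comm_ring_1 poly poly poly poly \<Rightarrow> 'a params \<Rightarrow> 'a" where
  "eval4 f (w, x, y, z) = poly (poly (poly (poly f [:[:[:z:]:]:]) [:[:y:]:]) [:x:]) w"

definition zariski_closed :: "'a::field params set \<Rightarrow> bool" where
  "zariski_closed S \<longleftrightarrow> (\<exists>P. S = {a. \<forall>f \<in> P. eval4 f a = 0})"

definition zariski_open :: "'a::field params set \<Rightarrow> bool" where
  "zariski_open U \<longleftrightarrow> zariski_closed (- U)"

text \<open>The four indeterminates, as elements of the rational function field over the rationals.\<close>

definition indets :: "rat poly poly poly poly fract params" where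
  "indets = (to_fract [:[:[:[:0, 1:]:]:]:], to_fract [:[:[:0, 1:]:]:],
             to_fract [:[:0, 1:]:], to_fract [:0, 1:])"

text \<open>The subfield generated by a set; in characteristic zero it contains the rationals.\<close>

definition generated_subfield :: "'a::field set \<Rightarrow> 'a set" where
  "generated_subfield S = \<Inter>{K. S \<subseteq> K \<and> 0 \<in> K \<and> 1 \<in> K \<and>
     (\<forall>x \<in> K. \<forall>y \<in> K. x + y \<in> K \<and> x * y \<in> K) \<and> (\<forall>x \<in> K. - x \<in> K \<and> inverse x \<in> K)}"

text \<open>\<open>polys_over K\<close> is \<open>K[z]\<close> for a subfield \<open>K\<close>; the next two definitions are
  divisibility and greatest common divisors in that ring.\<close>

definition polys_over :: "'a::field set \<Rightarrow> 'a poly set" where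
  "polys_over K = {f. \<forall>i. coeff f i \<in> K}"

definition dvd_over :: "'a::field set \<Rightarrow> 'a poly \<Rightarrow> 'a poly \<Rightarrow> bool" where
  "dvd_over K f g \<longleftrightarrow> f \<in> polys_over K \<and> g \<in> polys_over K \<and> (\<exists>h \<in> polys_over K. g = f * h)"

definition is_gcd_over :: "'a::field set \<Rightarrow> 'a poly \<Rightarrow> 'a poly \<Rightarrow> 'a poly \<Rightarrow> bool" where
  "is_gcd_over K f g d \<longleftrightarrow> dvd_over K d f \<and> dvd_over K d g \<and>
     (\<forall>e. dvd_over K e f \<longrightarrow> dvd_over K e g \<longrightarrow> dvd_over K e d)"

end

theory Submission
  imports Defs
begin

text \<open>
  Expand along rows. After some rows of the band matrix have been processed, exactly two of the four
  columns within reach are still unused, which gives six states and a sparse linear system for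
  their generating functions. Eliminating five of them leaves
  \<open>(\<Sum>n. F\<^sub>n(c) z\<^sup>n) (Q(z) - c z (1 - t z\<^sup>2) (1 + \<epsilon> t z\<^sup>2)) = 1 - t z\<^sup>2\<close>,
  and comparing coefficients of \<open>c\<^sup>k\<close> gives all generating functions. The recurrence degree is that of
  \<open>Q\<^sup>k\<^sup>+\<^sup>1\<close> once the fraction is reduced; this holds when \<open>t\<close>, \<open>v\<close> and
  \<open>v\<^sup>2 - 4 p\<^sup>2 t = (a\<^sub>-\<^sub>2 a\<^sub>1\<^sup>2 - a\<^sub>-\<^sub>1\<^sup>2 a\<^sub>2)\<^sup>2\<close> do not vanish, by explicit Bezout identities.
\<close>

no_notation vec_index (infixl \<open>$\<close> 100)

section \<open>First-row expansion of permanents and determinants\<close>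

text \<open>Sorting the permutations by the image j of 0 suffices: those with image j arise
  bijectively from the permutations of \<open>{0..<n}\<close> through
  \<open>permutation_insert 0 j\<close>, and the product over the remaining rows is then the one for
  the minor.\<close>

lemma permanent_expand_first_row:
  assumes A: "A \<in> carrier_mat (Suc n) (Suc n)"
  shows "permanent A = (\<Sum>j<Suc n. A $$ (0, j) * permanent (mat_delete A 0 j))"
proof -
  let ?S = "{p. p permutes {0..<Suc n}}" and ?Q = "{q. q permutes {0..<n}}"
  let ?h = "\<lambda>p. \<Prod>i = 0..<Suc n. A $$ (i, p i)"
  have "permanent A = sum ?h ?S"
    using A by (simp add: permanent_def)
  also have "\<dots> = (\<Sum>j\<in>{..<Suc n}. \<Sum>p\<in>{p \<in> ?S. p 0 = j}. ?h p)"
    by (rule sum.group[symmetric]) (auto simp: finite_permutations dest: permutes_in_image[of _ _ 0])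
  also have "\<dots> = (\<Sum>j<Suc n. A $$ (0, j) * permanent (mat_delete A 0 j))"
  proof (rule sum.cong[OF refl])
    fix j assume "j \<in> {..<Suc n}"
    hence j: "j < Suc n" by simp
    have "{p \<in> ?S. p 0 = j} = permutation_insert 0 j ` ?Q"
      using permutation_fix[of 0 n j] j by auto
    hence "(\<Sum>p\<in>{p \<in> ?S. p 0 = j}. ?h p) = (\<Sum>q\<in>?Q. ?h (permutation_insert 0 j q))"
      using sum.reindex[OF permutation_insert_inj_on[of 0 n j]] j by simp
    also have "\<dots> = (\<Sum>q\<in>?Q. A $$ (0, j) * (\<Prod>i = 0..<n. mat_delete A 0 j $$ (i, q i)))"
    proof (rule sum.cong[OF refl])
      fix q assume "q \<in> ?Q"
      hence q: "q i < n" if "i < n" for i using that by (auto dest: permutes_in_image[of _ _ i])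
      have "(\<Prod>i = 0..<n. A $$ (Suc i, permutation_insert 0 j q (Suc i))) =
            (\<Prod>i = 0..<n. mat_delete A 0 j $$ (i, q i))"
        using A q by (intro prod.cong) (auto simp: mat_delete_def permutation_insert_expand)
      thus "?h (permutation_insert 0 j q) =
            A $$ (0, j) * (\<Prod>i = 0..<n. mat_delete A 0 j $$ (i, q i))"
        by (simp add: prod.atLeast0_lessThan_Suc_shift del: prod.op_ivl_Suc)
    qed
    also have "\<dots> = A $$ (0, j) * permanent (mat_delete A 0 j)"
      using A by (simp add: permanent_def sum_distrib_left)
    finally show "(\<Sum>p\<in>{p \<in> ?S. p 0 = j}. ?h p) = A $$ (0, j) * permanent (mat_delete A 0 j)" .
  qed
  finally show ?thesis .
qed

definition perm_det :: "int \<Rightarrow> 'a::comm_ring_1 mat \<Rightarrow> 'a" where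
  "perm_det \<epsilon> = (if \<epsilon> = 1 then permanent else det)"

text \<open>The cofactor sign in row 0 is (-1)^j, which is \<epsilon>^j for the determinant, while
  \<epsilon>^j = 1 for the permanent. This common formula lets all later arguments treat both signs
  at once.\<close>

lemma perm_det_expand_first_row:
  assumes "\<epsilon> \<in> {1, -1}" and A: "A \<in> carrier_mat (Suc n) (Suc n)"
  shows "perm_det \<epsilon> A = (\<Sum>j<Suc n. A $$ (0, j) * (of_int \<epsilon> ^ j * perm_det \<epsilon> (mat_delete A 0 j)))"
proof (cases "\<epsilon> = 1")
  case True
  thus ?thesis using permanent_expand_first_row[OF A] by (simp add: perm_det_def)
next
  case False
  thus ?thesis using assms laplace_expansion_row[OF A, of 0]
    by (simp add: perm_det_def cofactor_def)
qed

lemma perm_det_0: "A \<in> carrier_mat 0 0 \<Longrightarrow> perm_det \<epsilon> A = 1"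
  by (auto simp: perm_det_def permanent_def det_def)

lemma perm_det_1:
  assumes "\<epsilon> \<in> {1, -1}" "A \<in> carrier_mat (Suc 0) (Suc 0)"
  shows "perm_det \<epsilon> A = A $$ (0, 0)"
proof -
  have "mat_delete A 0 0 \<in> carrier_mat 0 0" using mat_delete_carrier[OF assms(2)] by simp
  thus ?thesis using perm_det_expand_first_row[OF assms] by (simp add: perm_det_0)
qed

text \<open>Induction through the expansion: the term j = 0 has a zero entry, and every other minor
  keeps the zero column in front.\<close>

lemma perm_det_zero_column:
  assumes "\<epsilon> \<in> {1, -1}" "A \<in> carrier_mat (Suc n) (Suc n)" "\<And>i. i < Suc n \<Longrightarrow> A $$ (i, 0) = 0"
  shows "perm_det \<epsilon> A = 0"
  using assms(2,3)
proof (induction n arbitrary: A)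
  case 0
  thus ?case using perm_det_1[OF assms(1) 0(1)] by simp
next
  case (Suc n)
  have "A $$ (0, j) * (of_int \<epsilon> ^ j * perm_det \<epsilon> (mat_delete A 0 j)) = 0" if "j < Suc (Suc n)" for j
  proof (cases j)
    case 0
    thus ?thesis using Suc.prems by simp
  next
    case (Suc j')
    have "perm_det \<epsilon> (mat_delete A 0 j) = 0"
      using Suc.prems Suc that mat_delete_carrier[OF Suc.prems(1)]
      by (intro Suc.IH) (auto simp: mat_delete_def)
    thus ?thesis by simp
  qed
  thus ?case by (subst perm_det_expand_first_row[OF assms(1) Suc.prems(1)])
      (simp add: sum.neutral del: sum.lessThan_Suc)
qed

section \<open>Transfer recursion for the band matrix\<close>

definition penta_symbol :: "'a::zero \<Rightarrow> 'a \<Rightarrow> 'a \<Rightarrow> 'a \<Rightarrow> 'a \<Rightarrow> int \<Rightarrow> 'a" where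
  "penta_symbol am2 am1 c a1 a2 d =
     (if d = -2 then am2 else if d = -1 then am1 else if d = 0 then c
      else if d = 1 then a1 else if d = 2 then a2 else 0)"

text \<open>A minor of the band matrix, with the unused columns \<open>x < y\<close> first and the columns
  \<open>2, 3, \<dots>\<close> behind them. All indices are relative to the current row, so that an expansion step
  shifts them by one.\<close>

definition strip_mat :: "(int \<Rightarrow> 'a) \<Rightarrow> nat \<Rightarrow> int \<Rightarrow> int \<Rightarrow> 'a mat" where
  "strip_mat f n x y =
     mat n n (\<lambda>(i, j). f ((if j = 0 then x else if j = 1 then y else int j) - int i))"

lemma strip_mat_carrier [simp]: "strip_mat f n x y \<in> carrier_mat n n"
  by (simp add: strip_mat_def)

lemma penta_toeplitz_eq_strip_mat:
  "penta_toeplitz n am2 am1 c a1 a2 = strip_mat (penta_symbol am2 am1 c a1 a2) n 0 1"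
  by (rule eq_matI) (auto simp: penta_toeplitz_def strip_mat_def penta_symbol_def Let_def)

lemma mat_delete_strip_mat_0:
  "mat_delete (strip_mat f (Suc n) x y) 0 0 = strip_mat f n (y - 1) 1"
  by (rule eq_matI) (auto simp: mat_delete_def strip_mat_def intro!: arg_cong[of _ _ f])

lemma mat_delete_strip_mat_1:
  "mat_delete (strip_mat f (Suc n) x y) 0 (Suc 0) = strip_mat f n (x - 1) 1"
  by (rule eq_matI) (auto simp: mat_delete_def strip_mat_def intro!: arg_cong[of _ _ f])

lemma mat_delete_strip_mat_2:
  "mat_delete (strip_mat f (Suc n) x y) 0 (Suc (Suc 0)) = strip_mat f n (x - 1) (y - 1)"
  by (rule eq_matI) (auto simp: mat_delete_def strip_mat_def intro!: arg_cong[of _ _ f])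

text \<open>For \<open>n \<le> 1\<close> the matrix \<open>strip_mat f n x y\<close> is too small to contain both columns \<open>x\<close> and \<open>y\<close>.
  The values there are chosen such that the expansion step holds from \<open>n = 0\<close> on: the state counts
  only if the columns left over at the end are those outside the original matrix.\<close>

definition strip_state :: "int \<Rightarrow> (int \<Rightarrow> 'a::comm_ring_1) \<Rightarrow> int \<Rightarrow> int \<Rightarrow> nat \<Rightarrow> 'a" where
  "strip_state \<epsilon> f x y n =
     (if n = 0 then (if x = 0 \<and> y = 1 then 1 else 0)
      else if n = 1 \<and> y \<noteq> 1 then 0 else perm_det \<epsilon> (strip_mat f n x y))"

lemma strip_state_0_1: "strip_state \<epsilon> f 0 1 n = perm_det \<epsilon> (strip_mat f n 0 1)"
  by (simp add: strip_state_def perm_det_0)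

lemma perm_det_strip_mat_1:
  "\<epsilon> \<in> {1, -1} \<Longrightarrow> perm_det \<epsilon> (strip_mat f (Suc 0) x y) = f x"
  by (subst perm_det_1) (auto simp: strip_mat_def)

text \<open>Row 0 has nonzero entries at most in the columns \<open>x\<close>, \<open>y\<close> and
  2, as \<open>f\<close> vanishes beyond 2. These stand in positions 0, 1 and 2, with signs 1,
  \<epsilon> and \<epsilon>^2 = 1.\<close>

lemma strip_state_Suc:
  assumes \<epsilon>: "\<epsilon> \<in> {1, -1}" and "x < y" "y \<le> 1" and f: "\<And>d. d > 2 \<Longrightarrow> f d = 0"
  shows "strip_state \<epsilon> f x y (Suc n) =
           f x * strip_state \<epsilon> f (y - 1) 1 n + of_int \<epsilon> * f y * strip_state \<epsilon> f (x - 1) 1 n +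
           f 2 * strip_state \<epsilon> f (x - 1) (y - 1) n"
proof -
  have first: "strip_mat f (Suc m) x y $$ (0, j) =
      f (if j = 0 then x else if j = 1 then y else int j)" if "j < Suc m" for m j
    using that by (simp add: strip_mat_def)
  note expand = perm_det_expand_first_row[OF \<epsilon> strip_mat_carrier, of f _ x y]
  consider "n = 0" | "n = 1" | m where "n = Suc (Suc m)"
    by (metis One_nat_def not0_implies_Suc)
  thus ?thesis
  proof cases
    \<comment> \<open>Both sides are \<open>f x\<close> if \<open>y = 1\<close> and 0 otherwise:
      \<open>x < 1\<close> excludes the state (0, 1) in the last two summands.\<close>
    case 1
    thus ?thesis using assms by (auto simp: strip_state_def perm_det_strip_mat_1)
  next
    \<comment> \<open>A matrix with two columns contains no column 2. The third summand is 0 by the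
      convention for n = 1, since \<open>y - 1\<close> is not 1.\<close>
    case 2
    thus ?thesis using assms(2,3) expand[of 1]
      by (simp add: strip_state_def first mat_delete_strip_mat_0 mat_delete_strip_mat_1
          perm_det_strip_mat_1[OF \<epsilon>] algebra_simps)
  next
    case 3
    have "perm_det \<epsilon> (strip_mat f (Suc n) x y) =
      (\<Sum>j\<in>{0, Suc 0, Suc (Suc 0)}. strip_mat f (Suc n) x y $$ (0, j) *
        (of_int \<epsilon> ^ j * perm_det \<epsilon> (mat_delete (strip_mat f (Suc n) x y) 0 j)))"
      unfolding expand
    proof (rule sum.mono_neutral_right)
      show "\<forall>j\<in>{..<Suc n} - {0, Suc 0, Suc (Suc 0)}. strip_mat f (Suc n) x y $$ (0, j) *
        (of_int \<epsilon> ^ j * perm_det \<epsilon> (mat_delete (strip_mat f (Suc n) x y) 0 j)) = 0"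
        by (auto simp: first f)
    qed (auto simp: 3)
    moreover have "of_int \<epsilon> * (of_int \<epsilon> * z) = z" for z :: 'a using \<epsilon> by auto
    ultimately show ?thesis using 3
      by (simp add: strip_state_def first mat_delete_strip_mat_0 mat_delete_strip_mat_1
          mat_delete_strip_mat_2 algebra_simps)
  qed
qed

lemma strip_state_less:
  assumes \<epsilon>: "\<epsilon> \<in> {1, -1}" and "x < -2" and f: "\<And>d. d < -2 \<Longrightarrow> f d = 0"
  shows "strip_state \<epsilon> f x y n = 0"
proof (cases n)
  case 0
  thus ?thesis using assms(2) by (simp add: strip_state_def)
next
  case (Suc m)
  have "perm_det \<epsilon> (strip_mat f n x y) = 0"
    using assms(2) Suc by (intro perm_det_zero_column[OF \<epsilon>, of _ m]) (auto simp: strip_mat_def f)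
  thus ?thesis using Suc by (simp add: strip_state_def)
qed

text \<open>The ring is arbitrary so that \<open>c\<close> can later be a polynomial variable. The
  factor on the left has degree one in \<open>c\<close>, which is what makes extracting powers of
  \<open>c\<close> easy.\<close>

lemma penta_toeplitz_generating_function:
  fixes am2 am1 c a1 a2 :: "'a::comm_ring_1"
  assumes \<epsilon>: "\<epsilon> \<in> {1, -1}"
  defines "p \<equiv> fps_const (am1 * a1)" and "t \<equiv> fps_const (am2 * a2)"
    and "v \<equiv> fps_const (am2 * a1 ^ 2 + am1 ^ 2 * a2)" and "e \<equiv> of_int \<epsilon>" and "X \<equiv> fps_X"
  shows "Abs_fps (\<lambda>n. perm_det \<epsilon> (penta_toeplitz n am2 am1 c a1 a2)) *
           (1 - (e * p + t) * X ^ 2 - v * X ^ 3 - t * (e * p + t) * X ^ 4 + t ^ 3 * X ^ 6 -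
            fps_const c * X * (1 - t * X ^ 2) * (1 + e * t * X ^ 2)) = 1 - t * X ^ 2"
proof -
  define f where "f = penta_symbol am2 am1 c a1 a2"
  define G where "G x y = Abs_fps (strip_state \<epsilon> f x y)" for x y
  have f_gt: "f d = 0" if "d > 2" for d using that by (simp add: f_def penta_symbol_def)
  have f_lt: "f d = 0" if "d < -2" for d using that by (simp add: f_def penta_symbol_def)
  have f_simps: "f (-2) = am2" "f (-1) = am1" "f 0 = c" "f 1 = a1" "f 2 = a2"
    by (simp_all add: f_def penta_symbol_def)
  have G_Suc: "G x y = fps_const (if x = 0 \<and> y = 1 then 1 else 0) +
      X * (fps_const (f x) * G (y - 1) 1 + e * fps_const (f y) * G (x - 1) 1 +
           fps_const (f 2) * G (x - 1) (y - 1))" if "x < y" "y \<le> 1" for x y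
  proof (rule fps_ext)
    fix n
    have e: "e = fps_const (of_int \<epsilon>)" by (simp add: e_def fps_of_int)
    show "G x y $ n = (fps_const (if x = 0 \<and> y = 1 then 1 else 0) +
      X * (fps_const (f x) * G (y - 1) 1 + e * fps_const (f y) * G (x - 1) 1 +
           fps_const (f 2) * G (x - 1) (y - 1))) $ n"
    proof (cases n)
      case 0
      thus ?thesis by (simp add: G_def X_def strip_state_def)
    next
      case (Suc m)
      thus ?thesis using strip_state_Suc[OF \<epsilon> that f_gt]
        by (simp add: G_def X_def e mult.assoc)
    qed
  qed
  have G_lt: "G (-3) y = 0" for y
    by (rule fps_ext) (simp add: G_def strip_state_less[OF \<epsilon> _ f_lt])
  define A B C where "A = G 0 1" and "B = G (-1) 1" and "C = G (-1) 0"
  define m2 m1 c' p1 p2 where "m2 = fps_const am2" and "m1 = fps_const am1"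
    and "c' = fps_const c" and "p1 = fps_const a1" and "p2 = fps_const a2"
  note defs = A_def B_def C_def m2_def m1_def c'_def p1_def p2_def
  \<comment> \<open>Column -2 must be used in the current row, because index -3 lies outside the
    band. So each of the three states with x = -2 reduces to a single summand.\<close>
  have eE: "G (-2) 1 = X * m2 * A" and eF: "G (-2) 0 = X * m2 * B"
    using G_Suc[of "-2" 1] G_Suc[of "-2" 0] by (simp_all add: G_lt f_simps defs mult.assoc)
  have eG: "G (-2) (-1) = X * m2 * (X * m2 * A)"
    using G_Suc[of "-2" "-1"] eE by (simp add: G_lt f_simps m2_def mult.assoc)
  have eA: "A = 1 + X * (c' * A + e * p1 * B + p2 * C)"
    using G_Suc[of 0 1] by (simp add: f_simps defs)
  have eB: "B = X * (m1 * A + e * p1 * (X * m2 * A) + p2 * (X * m2 * B))"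
    using G_Suc[of "-1" 1] by (simp add: f_simps eE eF) (simp add: defs)
  have eC: "C = X * (m1 * B + e * c' * (X * m2 * A) + p2 * (X * m2 * (X * m2 * A)))"
    using G_Suc[of "-1" 0] by (simp add: f_simps eE eG) (simp add: defs)
  have pe: "p = m1 * p1" "t = m2 * p2" "v = m2 * p1 ^ 2 + m1 ^ 2 * p2"
    by (simp_all add: p_def t_def v_def defs fps_const_power)
  have e: "e = 1 \<or> e = -1" using \<epsilon> by (auto simp: e_def)
  have "A - X * (c' * A + e * p1 * B + p2 * C) = 1"
    by (subst (1) eA) simp
  \<comment> \<open>Substituting \<open>C\<close> into the equation for \<open>A\<close> leaves only
    \<open>A\<close> and \<open>B\<close>.\<close>
  hence 1: "A * (1 - c' * X - e * c' * t * X ^ 3 - t ^ 2 * X ^ 4) =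
      1 + (e * p1 * X + p2 * m1 * X ^ 2) * B"
    unfolding eC pe by (simp add: algebra_simps eval_nat_numeral)
  have "B - X * (m1 * A + e * p1 * (X * m2 * A) + p2 * (X * m2 * B)) = 0"
    by (subst (1) eB) simp
  hence 2: "B * (1 - t * X ^ 2) = (m1 * X + e * p1 * m2 * X ^ 2) * A"
    unfolding pe by (simp add: algebra_simps eval_nat_numeral)
  \<comment> \<open>\<open>B\<close> is removed by multiplying equation \<open>1\<close> by 1 - t
    X^2 and replacing (1 - t X^2) B through equation \<open>2\<close>. The case split on
    \<open>e\<close> supplies e^2 = 1.\<close>
  have "A * (1 - (e * p + t) * X ^ 2 - v * X ^ 3 - t * (e * p + t) * X ^ 4 + t ^ 3 * X ^ 6 -
            c' * X * (1 - t * X ^ 2) * (1 + e * t * X ^ 2)) =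
    A * (1 - c' * X - e * c' * t * X ^ 3 - t ^ 2 * X ^ 4) * (1 - t * X ^ 2) -
    (e * p1 * X + p2 * m1 * X ^ 2) * ((m1 * X + e * p1 * m2 * X ^ 2) * A)"
    using e unfolding pe by (elim disjE) (simp_all add: algebra_simps eval_nat_numeral)
  also have "\<dots> = 1 - t * X ^ 2"
    unfolding 1 2[symmetric] by (simp add: algebra_simps)
  finally have "A * (1 - (e * p + t) * X ^ 2 - v * X ^ 3 - t * (e * p + t) * X ^ 4 + t ^ 3 * X ^ 6 -
            c' * X * (1 - t * X ^ 2) * (1 + e * t * X ^ 2)) = 1 - t * X ^ 2" .
  moreover have "A = Abs_fps (\<lambda>n. perm_det \<epsilon> (penta_toeplitz n am2 am1 c a1 a2))"
    by (intro fps_ext) (simp add: A_def G_def strip_state_0_1 penta_toeplitz_eq_strip_mat f_def)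
  ultimately show ?thesis by (simp add: c'_def)
qed

subsection \<open>Coefficients of the diagonal variable\<close>

text \<open>An element of \<open>'a poly fps\<close> is read as a series in z whose coefficients are
  polynomials in the diagonal variable c. Extracting c^k is then linear over the series free of c,
  which \<open>const_fps\<close> embeds.\<close>

definition coeff_fps :: "nat \<Rightarrow> 'a::comm_ring_1 poly fps \<Rightarrow> 'a fps" where
  "coeff_fps k F = Abs_fps (\<lambda>n. coeff (F $ n) k)"

definition const_fps :: "'a::comm_ring_1 fps \<Rightarrow> 'a poly fps" where
  "const_fps g = Abs_fps (\<lambda>n. [:g $ n:])"

lemma const_poly_sum: "[:sum f S:] = (\<Sum>x\<in>S. [:f x:])"
  by (rule poly_eqI) (simp add: coeff_pCons coeff_sum split: nat.split)

lemma const_fps_hom: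
  "const_fps 1 = 1" "const_fps (fps_const c) = fps_const [:c:]" "const_fps fps_X = fps_X"
  "const_fps (g + h) = const_fps g + const_fps h" "const_fps (g - h) = const_fps g - const_fps h"
  "const_fps (g * h) = const_fps g * const_fps h"
  by (rule fps_ext; simp add: const_fps_def fps_mult_nth const_poly_sum pCons_one; simp add: mult.commute)+

lemma const_fps_power: "const_fps (g ^ n) = const_fps g ^ n"
  by (induction n) (simp_all add: const_fps_hom)

lemma const_fps_of_int: "const_fps (of_int m) = of_int m"
  by (simp add: fps_of_int const_fps_hom of_int_poly flip: fps_of_int)

lemma coeff_fps_diff: "coeff_fps k (F - G) = coeff_fps k F - coeff_fps k G"
  by (rule fps_ext) (simp add: coeff_fps_def)

lemma coeff_fps_const: "coeff_fps k (const_fps g) = (if k = 0 then g else 0)"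
  by (rule fps_ext) (simp add: coeff_fps_def const_fps_def coeff_pCons split: nat.split)

lemma coeff_fps_mult_const: "coeff_fps k (F * const_fps g) = coeff_fps k F * g"
  by (rule fps_ext) (simp add: coeff_fps_def const_fps_def fps_mult_nth coeff_sum, simp add: mult.commute)

lemma coeff_fps_mult_var:
  "coeff_fps k (F * fps_const [:0, 1:]) = (if k = 0 then 0 else coeff_fps (k - 1) F)"
  by (rule fps_ext) (simp add: coeff_fps_def coeff_pCons split: nat.split)

definition F_fps :: "int \<Rightarrow> 'a::comm_ring_1 params \<Rightarrow> nat \<Rightarrow> 'a fps" where
  "F_fps \<epsilon> a k = Abs_fps (\<lambda>n. coeff (F_poly \<epsilon> a n) k)"

lemma fps_of_Q_poly:
  "fps_of_poly (Q_poly \<epsilon> a) =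
     1 - (of_int \<epsilon> * fps_const (par_p a) + fps_const (par_t a)) * fps_X ^ 2
       - fps_const (par_v a) * fps_X ^ 3
       - fps_const (par_t a) * (of_int \<epsilon> * fps_const (par_p a) + fps_const (par_t a)) * fps_X ^ 4
       + fps_const (par_t a) ^ 3 * fps_X ^ 6"
  by (simp add: Q_poly_def Let_def fps_of_poly_simps fps_of_poly_monom fps_of_int
      flip: fps_const_mult fps_const_add fps_const_power)

text \<open>In F (Q - c z s r) = s, apart from F itself, c occurs only to the first power. Comparing
  coefficients of c^0 gives the first claim, those of c^(k+1) the second.\<close>

lemma F_fps_recurrence:
  fixes a :: "'a::comm_ring_1 params"
  assumes \<epsilon>: "\<epsilon> \<in> {1, -1}"
  defines "s \<equiv> 1 - fps_const (par_t a) * fps_X ^ 2"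
    and "r \<equiv> 1 + fps_const (of_int \<epsilon> * par_t a) * fps_X ^ 2"
  shows "F_fps \<epsilon> a 0 * fps_of_poly (Q_poly \<epsilon> a) = s"
    and "F_fps \<epsilon> a (Suc k) * fps_of_poly (Q_poly \<epsilon> a) = F_fps \<epsilon> a k * (fps_X * s * r)"
proof -
  obtain am2 am1 a1 a2 where a: "a = (am2, am1, a1, a2)" by (cases a) auto
  define F where "F = Abs_fps (F_poly \<epsilon> a)"
  have F_eq: "F = Abs_fps (\<lambda>n. perm_det \<epsilon> (penta_toeplitz n [:am2:] [:am1:] [:0, 1:] [:a1:] [:a2:]))"
    by (intro fps_ext) (simp add: F_def a perm_det_def)
  have c: "[:am1:] * [:a1:] = [:par_p a:]" "[:am2:] * [:a2:] = [:par_t a:]"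
    "[:am2:] * [:a1:] ^ 2 + [:am1:] ^ 2 * [:a2:] = [:par_v a:]"
    by (simp_all add: a power2_eq_square)
  have r: "r = 1 + of_int \<epsilon> * fps_const (par_t a) * fps_X ^ 2"
    by (simp add: r_def fps_of_int flip: fps_const_mult)
  have rs: "const_fps s = 1 - fps_const [:par_t a:] * fps_X ^ 2"
    "const_fps r = 1 + of_int \<epsilon> * fps_const [:par_t a:] * fps_X ^ 2"
    unfolding r s_def by (simp_all only: const_fps_hom const_fps_power const_fps_of_int)
  have Q: "const_fps (fps_of_poly (Q_poly \<epsilon> a)) =
      1 - (of_int \<epsilon> * fps_const [:par_p a:] + fps_const [:par_t a:]) * fps_X ^ 2
       - fps_const [:par_v a:] * fps_X ^ 3
       - fps_const [:par_t a:] * (of_int \<epsilon> * fps_const [:par_p a:] + fps_const [:par_t a:]) * fps_X ^ 4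
       + fps_const [:par_t a:] ^ 3 * fps_X ^ 6"
    unfolding fps_of_Q_poly by (simp only: const_fps_hom const_fps_power const_fps_of_int)
  have "F * (const_fps (fps_of_poly (Q_poly \<epsilon> a)) -
      fps_const [:0, 1:] * fps_X * const_fps s * const_fps r) = const_fps s"
    using penta_toeplitz_generating_function[OF \<epsilon>, of "[:am2:]" "[:am1:]" "[:0, 1:]" "[:a1:]" "[:a2:]"]
    unfolding F_eq[symmetric] c Q rs .
  hence eq: "F * const_fps (fps_of_poly (Q_poly \<epsilon> a)) -
      F * const_fps (fps_X * s * r) * fps_const [:0, 1:] = const_fps s"
    by (simp add: const_fps_hom algebra_simps)
  have *: "coeff_fps k F * fps_of_poly (Q_poly \<epsilon> a) -
      (if k = 0 then 0 else coeff_fps (k - 1) F * (fps_X * s * r)) = (if k = 0 then s else 0)" for k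
    using arg_cong[OF eq, of "coeff_fps k"]
    by (simp only: coeff_fps_diff coeff_fps_mult_const coeff_fps_mult_var coeff_fps_const split: if_splits)
  have F: "coeff_fps k F = F_fps \<epsilon> a k" for k
    by (simp add: coeff_fps_def F_fps_def F_def)
  show "F_fps \<epsilon> a 0 * fps_of_poly (Q_poly \<epsilon> a) = s"
    using *[of 0] F by simp
  show "F_fps \<epsilon> a (Suc k) * fps_of_poly (Q_poly \<epsilon> a) = F_fps \<epsilon> a k * (fps_X * s * r)"
    using *[of "Suc k"] F by simp
qed

lemma F_fps_times_Q_power:
  fixes a :: "'a::comm_ring_1 params"
  assumes \<epsilon>: "\<epsilon> \<in> {1, -1}"
  shows "F_fps \<epsilon> a k * fps_of_poly (Q_poly \<epsilon> a) ^ (k + 1) =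
    fps_X ^ k * (1 - fps_const (par_t a) * fps_X ^ 2) ^ (k + 1) *
      (1 + fps_const (of_int \<epsilon> * par_t a) * fps_X ^ 2) ^ k"
proof (induction k)
  case 0
  thus ?case using F_fps_recurrence(1)[OF \<epsilon>] by simp
next
  case (Suc k)
  define Q where "Q = fps_of_poly (Q_poly \<epsilon> a)"
  define s where "s = 1 - fps_const (par_t a) * fps_X ^ 2"
  define r where "r = 1 + fps_const (of_int \<epsilon> * par_t a) * fps_X ^ 2"
  have "F_fps \<epsilon> a (Suc k) * Q ^ (Suc k + 1) = (F_fps \<epsilon> a (Suc k) * Q) * Q ^ (k + 1)"
    by (simp add: mult_ac)
  also have "F_fps \<epsilon> a (Suc k) * Q = F_fps \<epsilon> a k * (fps_X * s * r)"
    unfolding Q_def s_def r_def by (rule F_fps_recurrence(2)[OF \<epsilon>])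
  also have "\<dots> * Q ^ (k + 1) = (F_fps \<epsilon> a k * Q ^ (k + 1)) * (fps_X * s * r)"
    by (simp add: mult_ac)
  also have "\<dots> = fps_X ^ Suc k * s ^ (Suc k + 1) * r ^ Suc k"
    using Suc unfolding Q_def s_def r_def by (simp add: mult_ac)
  finally show ?case unfolding Q_def s_def r_def .
qed

lemma fps_of_Q_poly_nz: "fps_of_poly (Q_poly \<epsilon> a) \<noteq> 0" for a :: "'a::comm_ring_1 params"
proof -
  have "fps_of_poly (Q_poly \<epsilon> a) $ 0 = 1"
    by (simp add: Q_poly_def Let_def)
  thus ?thesis by auto
qed

lemma Z_fps_eq_F_fps: "Z_fps \<epsilon> a = F_fps \<epsilon> a 0"
  by (rule fps_ext) (simp add: Z_fps_def F_fps_def Z_seq_def poly_0_coeff_0)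

text \<open>Since Z Q = 1 - t z^2, the power (1 - t z^2)^(k+1) in the product formula equals Z^(k+1)
  Q^(k+1), and Q^(k+1) cancels.\<close>

lemma F_fps_eq:
  fixes a :: "'a::field params"
  assumes \<epsilon>: "\<epsilon> \<in> {1, -1}"
  shows "F_fps \<epsilon> a k = fps_X ^ k *
    ((1 + fps_const (of_int \<epsilon> * par_t a) * fps_X ^ 2) ^ k * Z_fps \<epsilon> a ^ (k + 1))"
proof -
  define Q where "Q = fps_of_poly (Q_poly \<epsilon> a)"
  have "Q \<noteq> 0" unfolding Q_def by (rule fps_of_Q_poly_nz)
  have Z: "(Z_fps \<epsilon> a * Q) ^ (k + 1) = (1 - fps_const (par_t a) * fps_X ^ 2) ^ (k + 1)"
    unfolding Z_fps_eq_F_fps Q_def using F_fps_recurrence(1)[OF \<epsilon>, of a] by simp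
  have "F_fps \<epsilon> a k * Q ^ (k + 1) = fps_X ^ k *
    ((1 + fps_const (of_int \<epsilon> * par_t a) * fps_X ^ 2) ^ k * Z_fps \<epsilon> a ^ (k + 1)) * Q ^ (k + 1)"
    unfolding Q_def F_fps_times_Q_power[OF \<epsilon>] Z[symmetric, unfolded Q_def]
    by (simp only: power_mult_distrib mult_ac)
  thus ?thesis using \<open>Q \<noteq> 0\<close> by simp
qed

text \<open>Lists of length k + 1 with sum m, over which \<open>natpermute\<close> ranges,
  correspond to extensional functions on \<open>{0..k}\<close> with the same sum.\<close>

lemma fps_power_nth_PiE:
  fixes G :: "'a::comm_ring_1 fps"
  shows "(G ^ (k + 1)) $ m =
    (\<Sum>r | r \<in> {0..k} \<rightarrow>\<^sub>E (UNIV :: nat set) \<and> (\<Sum>i = 0..k. r i) = m. \<Prod>i = 0..k. G $ r i)"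
proof -
  have "(G ^ (k + 1)) $ m = (\<Sum>l\<in>natpermute m (k + 1). \<Prod>i = 0..k. G $ (l ! i))"
    using fps_power_nth_Suc[of G k m] by simp
  also have "\<dots> = (\<Sum>r | r \<in> {0..k} \<rightarrow>\<^sub>E (UNIV :: nat set) \<and> (\<Sum>i = 0..k. r i) = m. \<Prod>i = 0..k. G $ r i)"
  proof (rule sum.reindex_bij_witness[where j = "\<lambda>l. restrict ((!) l) {0..k}" and i = "\<lambda>r. map r [0..<k + 1]"])
    fix l assume "l \<in> natpermute m (k + 1)"
    hence l: "length l = k + 1" "sum_list l = m" by (auto simp: natpermute_def)
    show "map (restrict ((!) l) {0..k}) [0..<k + 1] = l"
      using l(1) by (intro nth_equalityI) (auto simp del: upt_Suc)
    show "restrict ((!) l) {0..k} \<in> {r \<in> {0..k} \<rightarrow>\<^sub>E UNIV. (\<Sum>i = 0..k. r i) = m}"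
      using l by (auto simp: sum_list_sum_nth atLeastLessThanSuc_atLeastAtMost)
    show "(\<Prod>i = 0..k. G $ restrict ((!) l) {0..k} i) = (\<Prod>i = 0..k. G $ (l ! i))"
      by (rule prod.cong) auto
  next
    fix r :: "nat \<Rightarrow> nat" assume r: "r \<in> {r \<in> {0..k} \<rightarrow>\<^sub>E UNIV. (\<Sum>i = 0..k. r i) = m}"
    show "restrict ((!) (map r [0..<k + 1])) {0..k} = r"
      using r by (auto simp: fun_eq_iff PiE_def extensional_def simp del: upt_Suc)
    show "map r [0..<k + 1] \<in> natpermute m (k + 1)"
      using r by (auto simp: natpermute_def sum_list_sum_nth atLeastLessThanSuc_atLeastAtMost simp del: upt_Suc)
  qed
  finally show ?thesis .
qed

text \<open>The binomial theorem splits the first factor, and each z^(2j) shifts the exponent.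
  Comparing exponents as integers avoids truncated subtraction.\<close>

lemma fps_coeff_power_expand:
  fixes G :: "'a::comm_ring_1 fps"
  shows "fps_coeff ((1 + fps_const w * fps_X ^ 2) ^ k * G ^ (k + 1)) m =
    (\<Sum>j = 0..k. of_nat (k choose j) * w ^ j *
       (\<Sum>r | r \<in> {0..k} \<rightarrow>\<^sub>E (UNIV :: nat set) \<and> int (\<Sum>i = 0..k. r i) = m - 2 * int j.
          \<Prod>i = 0..k. G $ r i))"
proof -
  have shift: "fps_coeff (fps_X ^ (2 * j) * G ^ (k + 1)) m =
    (\<Sum>r | r \<in> {0..k} \<rightarrow>\<^sub>E (UNIV :: nat set) \<and> int (\<Sum>i = 0..k. r i) = m - 2 * int j.
          \<Prod>i = 0..k. G $ r i)" for j
  proof (cases "m < 2 * int j")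
    \<comment> \<open>For a negative exponent m - 2j the index set is empty, in agreement with the
      zero coefficient.\<close>
    case True
    have "int (\<Sum>i = 0..k. r i) \<noteq> m - 2 * int j" for r
      using True by linarith
    thus ?thesis using True by (auto simp: fps_coeff_def fps_X_power_mult_nth)
  next
    case False
    have "int s = m - 2 * int j \<longleftrightarrow> s = nat m - 2 * j" for s
      using False by linarith
    moreover have "fps_coeff (fps_X ^ (2 * j) * G ^ (k + 1)) m = (G ^ (k + 1)) $ (nat m - 2 * j)"
      using False by (auto simp: fps_coeff_def fps_X_power_mult_nth nat_less_iff)
    ultimately show ?thesis
      unfolding fps_power_nth_PiE by (simp del: of_nat_sum)
  qed
  have "(1 + fps_const w * fps_X ^ 2) ^ k * G ^ (k + 1) =
      (\<Sum>j = 0..k. fps_const (of_nat (k choose j) * w ^ j) * (fps_X ^ (2 * j) * G ^ (k + 1)))"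
  proof -
    have "(1 + fps_const w * fps_X ^ 2) ^ k = (fps_const w * fps_X ^ 2 + 1) ^ k"
      by (simp add: add.commute)
    also have "\<dots> = (\<Sum>j = 0..k. fps_const (of_nat (k choose j) * w ^ j) * fps_X ^ (2 * j))"
      unfolding binomial_ring atLeast0AtMost
      by (intro sum.cong refl) (simp add: power_mult_distrib fps_of_nat power_mult mult.assoc
          flip: fps_const_mult fps_const_power)
    finally show ?thesis by (simp only: sum_distrib_right mult.assoc)
  qed
  hence "fps_coeff ((1 + fps_const w * fps_X ^ 2) ^ k * G ^ (k + 1)) m =
      (\<Sum>j = 0..k. of_nat (k choose j) * w ^ j * fps_coeff (fps_X ^ (2 * j) * G ^ (k + 1)) m)"
    by (simp add: fps_coeff_def fps_sum_nth)
  thus ?thesis unfolding shift .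
qed

subsection \<open>Rational generating functions and recurrence degree\<close>

text \<open>Coprimality is encoded by a Bezout identity because explicit cofactors are at hand, and
  because such identities multiply, hence pass to products and powers.\<close>

definition bezout_coprime :: "'a::comm_ring_1 \<Rightarrow> 'a \<Rightarrow> bool" where
  "bezout_coprime f g \<longleftrightarrow> (\<exists>u v. u * f + v * g = 1)"

lemma bezout_coprimeI: "u * f + v * g = 1 \<Longrightarrow> bezout_coprime f g"
  unfolding bezout_coprime_def by blast

lemma bezout_coprime_sym: "bezout_coprime f g \<Longrightarrow> bezout_coprime g f"
  unfolding bezout_coprime_def by (metis add.commute)

lemma bezout_coprime_1: "bezout_coprime f 1"
  by (rule bezout_coprimeI[of 0 _ 1]) simp

lemma bezout_coprime_mult:
  assumes "bezout_coprime f g" "bezout_coprime f h"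
  shows "bezout_coprime f (g * h)"
proof -
  obtain u v u' v' where "u * f + v * g = 1" "u' * f + v' * h = 1"
    using assms unfolding bezout_coprime_def by blast
  hence "(u * f + v * g) * (u' * f + v' * h) = 1" by simp
  hence "(u * u' * f + u * v' * h + v * g * u') * f + (v * v') * (g * h) = 1"
    by (simp add: algebra_simps)
  thus ?thesis by (rule bezout_coprimeI)
qed

lemma bezout_coprime_power: "bezout_coprime f g \<Longrightarrow> bezout_coprime f (g ^ n)"
  by (induction n) (auto intro: bezout_coprime_mult bezout_coprime_1)

lemma bezout_coprime_dvd_1: "bezout_coprime f g \<Longrightarrow> e dvd f \<Longrightarrow> e dvd g \<Longrightarrow> e dvd 1"
  unfolding bezout_coprime_def by (metis dvd_add dvd_mult)

lemma bezout_coprime_dvd_mult: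
  assumes "bezout_coprime f g" "f dvd g * h"
  shows "f dvd h"
proof -
  obtain u v where "u * f + v * g = 1" using assms(1) unfolding bezout_coprime_def by blast
  hence "h * (u * f + v * g) = h" by simp
  hence "h * u * f + v * (g * h) = h" by (simp only: distrib_left mult_ac)
  moreover have "f dvd h * u * f + v * (g * h)" using dvd_mult[OF assms(2), of v] by simp
  ultimately show ?thesis by (simp only:)
qed

text \<open>A recurrence of length d is a polynomial R with constant term 1 and degree at most d
  such that the series times R is a polynomial of degree below d. Q is such an R. Any other one
  gives N/Q = P/R, so Q divides N R, hence R by coprimality, and degree Q \<le> d.\<close>

lemma min_recurrence_degree_rational:
  fixes u :: "nat \<Rightarrow> 'a::field"
  assumes gf: "Abs_fps u * fps_of_poly Q = fps_of_poly N"
    and Q0: "coeff Q 0 = 1" and deg: "degree N < degree Q" and cop: "bezout_coprime Q N"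
  shows "min_recurrence_degree u (degree Q)"
  unfolding min_recurrence_degree_def
proof (intro conjI allI impI)
  \<comment> \<open>The coefficient of z^(n+d) in the product is the left side of the recurrence at
    n.\<close>
  have conv: "(Abs_fps u * fps_of_poly R) $ (n + d) =
      coeff R 0 * u (n + d) + (\<Sum>i = 1..d. coeff R i * u (n + d - i))"
    if "degree R \<le> d" for R n d
  proof -
    have "(Abs_fps u * fps_of_poly R) $ (n + d) = (\<Sum>i = 0..n + d. coeff R i * u (n + d - i))"
      by (subst mult.commute) (simp add: fps_mult_nth)
    also have "\<dots> = (\<Sum>i = 0..d. coeff R i * u (n + d - i))"
      using that by (intro sum.mono_neutral_right) (auto intro!: coeff_eq_0)
    finally show ?thesis by (simp add: sum.atLeast_Suc_atMost)
  qed
  show "satisfies_recurrence u (degree Q)"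
    unfolding satisfies_recurrence_def
  proof (intro exI allI)
    fix n
    have "(Abs_fps u * fps_of_poly Q) $ (n + degree Q) = 0"
      unfolding gf using deg by (simp add: coeff_eq_0)
    thus "u (n + degree Q) + (\<Sum>i = 1..degree Q. coeff Q i * u (n + degree Q - i)) = 0"
      using conv[of Q "degree Q" n] Q0 by simp
  qed
  fix d assume d: "d < degree Q"
  show "\<not> satisfies_recurrence u d"
  proof
    assume "satisfies_recurrence u d"
    then obtain c where c: "u (n + d) + (\<Sum>i = 1..d. c i * u (n + d - i)) = 0" for n
      unfolding satisfies_recurrence_def by blast
    \<comment> \<open>This is the reversed characteristic polynomial. As \<open>c d\<close> may
      vanish, its degree is only bounded by d.\<close>
    define R where "R = 1 + (\<Sum>i = 1..d. monom (c i) i)"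
    have Ri: "coeff R i = c i" if "i \<in> {1..d}" for i
      using that by (simp add: R_def coeff_sum)
    have R0: "coeff R 0 = 1" by (simp add: R_def coeff_sum)
    have degR: "degree R \<le> d"
      by (rule degree_le) (auto simp: R_def coeff_sum)
    have "(Abs_fps u * fps_of_poly R) $ m = 0" if "m \<ge> d" for m
    proof -
      define n where "n = m - d"
      have m: "m = n + d" using that by (simp add: n_def)
      have "(\<Sum>i = 1..d. coeff R i * u (n + d - i)) = (\<Sum>i = 1..d. c i * u (n + d - i))"
        by (intro sum.cong refl) (simp only: Ri)
      thus ?thesis unfolding m conv[OF degR] R0 using c[of n] by (simp only: mult_1)
    qed
    hence "\<exists>P. Abs_fps u * fps_of_poly R = fps_of_poly P"
      by (intro exI[of _ "truncate_fps d (Abs_fps u * fps_of_poly R)"])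
        (simp add: fps_eq_iff coeff_truncate_fps)
    then obtain P where P: "Abs_fps u * fps_of_poly R = fps_of_poly P" by blast
    have "fps_of_poly (N * R) = fps_of_poly (Q * P)"
      unfolding fps_of_poly_mult gf[symmetric] P[symmetric] by (simp only: mult_ac)
    hence "Q dvd N * R" by simp
    hence "Q dvd R" by (rule bezout_coprime_dvd_mult[OF cop])
    moreover have "R \<noteq> 0" using R0 by auto
    ultimately have "degree Q \<le> degree R" by (rule dvd_imp_degree_le)
    thus False using degR d by simp
  qed
qed

section \<open>Bezout identities for Q\<close>

text \<open>Modulo 1 - t z^2, t Q is congruent to -(2\<epsilon>p + v z), with quotient
  \<open>w\<close>. Multiplying by t (2\<epsilon>p - v z) gives t v^2 z^2 - 4 p^2 t, and t z^2 is
  congruent to 1.\<close>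

lemma Q_cofactor_minus:
  fixes e p t v z :: "'a::comm_ring_1"
  defines "Q \<equiv> 1 - (e * p + t) * z ^ 2 - v * z ^ 3 - t * (e * p + t) * z ^ 4 + t ^ 3 * z ^ 6"
    and "w \<equiv> t + 2 * e * p + v * z + e * p * t * z ^ 2 - t ^ 3 * z ^ 4"
  assumes e: "e * e = 1"
  shows "t ^ 2 * (2 * e * p - v * z) * Q + (v ^ 2 - t * (2 * e * p - v * z) * w) * (1 - t * z ^ 2) =
    v ^ 2 - 4 * p ^ 2 * t"
proof -
  have 1: "t * Q = w * (1 - t * z ^ 2) - (2 * e * p + v * z)"
    unfolding Q_def w_def by (simp add: algebra_simps eval_nat_numeral)
  have "t ^ 2 * (2 * e * p - v * z) * Q = t * (2 * e * p - v * z) * (t * Q)"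
    by (simp add: power2_eq_square)
  moreover have "e * (e * x) = x" for x
    using e by (simp flip: mult.assoc)
  ultimately show ?thesis unfolding 1 by (simp add: algebra_simps eval_nat_numeral)
qed

text \<open>Modulo 1 + t z^2, t Q is congruent to v z when \<epsilon> = 1, and multiplying by -t z
  gives -t v z^2, congruent to v. The factor \<open>1 * p\<close> matches the definition of Q with
  \<open>e\<close> replaced by 1.\<close>

lemma Q_cofactor_plus:
  fixes p t v z :: "'a::comm_ring_1"
  shows "- (z * t ^ 2) *
      (1 - (1 * p + t) * z ^ 2 - v * z ^ 3 - t * (1 * p + t) * z ^ 4 + t ^ 3 * z ^ 6) +
    (v + t ^ 2 * z - t * v * z ^ 2 - (p * t ^ 2 + 2 * t ^ 3) * z ^ 3 + t ^ 4 * z ^ 5) * (1 + t * z ^ 2) = v"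
  by (simp add: algebra_simps eval_nat_numeral)

lemma Q_cofactor_var:
  fixes q2 q3 q4 q6 z :: "'a::comm_ring_1"
  shows "1 * (1 - q2 * z ^ 2 - q3 * z ^ 3 - q4 * z ^ 4 + q6 * z ^ 6) +
    (q2 * z + q3 * z ^ 2 + q4 * z ^ 3 - q6 * z ^ 5) * z = 1"
  by (simp add: algebra_simps eval_nat_numeral)

lemma Q_poly_bezout:
  fixes a :: "'a::field params"
  assumes \<epsilon>: "\<epsilon> \<in> {1, -1}" and "par_t a \<noteq> 0" "par_v a \<noteq> 0" "par_v a ^ 2 \<noteq> 4 * par_p a ^ 2 * par_t a"
  shows "bezout_coprime (Q_poly \<epsilon> a) [:0, 1:]"
    and "bezout_coprime (Q_poly \<epsilon> a) (1 - monom (par_t a) 2)"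
    and "bezout_coprime (Q_poly \<epsilon> a) (1 + monom (of_int \<epsilon> * par_t a) 2)"
proof -
  define Z p t v e where "Z = [:0, 1 :: 'a:]" and "p = [:par_p a:]" and "t = [:par_t a:]"
    and "v = [:par_v a:]" and "e = (of_int \<epsilon> :: 'a poly)"
  define Q where "Q = 1 - (e * p + t) * Z ^ 2 - v * Z ^ 3 - t * (e * p + t) * Z ^ 4 + t ^ 3 * Z ^ 6"
  have monom: "monom c n = [:c:] * Z ^ n" for c n
    by (simp add: Z_def monom_altdef)
  have t_const: "[:par_t a:] = t" by (simp add: t_def)
  have e_const: "e = [:of_int \<epsilon>:]" by (simp add: e_def of_int_poly)
  have Q: "Q_poly \<epsilon> a = Q"
    unfolding Q_poly_def Let_def monom Q_def
    by (simp add: p_def t_def v_def e_const poly_const_pow mult.commute)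
  have e: "e * e = 1" using \<epsilon> by (auto simp: e_def)
  have scale: "bezout_coprime f g" if "u * f + w * g = [:c:]" "c \<noteq> 0" for u w f g and c :: 'a
  proof (rule bezout_coprimeI)
    have "([:inverse c:] * u) * f + ([:inverse c:] * w) * g = [:inverse c:] * (u * f + w * g)"
      by (simp only: distrib_left mult.assoc)
    thus "([:inverse c:] * u) * f + ([:inverse c:] * w) * g = 1"
      using that by (simp add: one_pCons)
  qed
  show "bezout_coprime (Q_poly \<epsilon> a) [:0, 1:]"
    unfolding Q Q_def Z_def[symmetric]
    by (rule bezout_coprimeI, rule Q_cofactor_var)
  have "v ^ 2 - 4 * p ^ 2 * t = [:par_v a ^ 2 - 4 * par_p a ^ 2 * par_t a:]"
    by (simp add: v_def p_def t_def poly_const_pow numeral_poly)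
  note Q_cofactor_minus[OF e, of t p v Z, folded Q_def, unfolded this]
  hence t: "bezout_coprime Q (1 - t * Z ^ 2)"
    by (rule scale) (use assms(4) in simp)
  thus "bezout_coprime (Q_poly \<epsilon> a) (1 - monom (par_t a) 2)"
    by (simp add: Q monom t_const)
  show "bezout_coprime (Q_poly \<epsilon> a) (1 + monom (of_int \<epsilon> * par_t a) 2)"
  proof (cases "\<epsilon> = 1")
    case True
    hence e: "e = 1" by (simp add: e_def)
    have "- (Z * t ^ 2) * Q +
        (v + t ^ 2 * Z - t * v * Z ^ 2 - (p * t ^ 2 + 2 * t ^ 3) * Z ^ 3 + t ^ 4 * Z ^ 5) * (1 + t * Z ^ 2) =
        [:par_v a:]"
      unfolding Q_def e v_def[symmetric] by (rule Q_cofactor_plus)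
    from scale[OF this assms(3)] show ?thesis using True by (simp add: Q[unfolded True] monom t_const)
  next
    \<comment> \<open>For \<epsilon> = -1 this factor is 1 - t z^2 again, which is already
      treated.\<close>
    case False
    hence "1 + monom (of_int \<epsilon> * par_t a) 2 = 1 - monom (par_t a) 2"
      using \<epsilon> by (simp flip: minus_monom)
    thus ?thesis using t by (simp add: Q monom t_const)
  qed
qed

lemma coeff_0_Q_poly: "coeff (Q_poly \<epsilon> a) 0 = 1"
  by (simp add: Q_poly_def Let_def)

lemma degree_Q_poly:
  fixes a :: "'a::field params"
  assumes "par_t a \<noteq> 0"
  shows "degree (Q_poly \<epsilon> a) = 6"
proof (rule antisym)
  show "degree (Q_poly \<epsilon> a) \<le> 6"
    by (rule degree_le) (simp add: Q_poly_def Let_def)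
  show "6 \<le> degree (Q_poly \<epsilon> a)"
    using assms by (intro le_degree) (simp add: Q_poly_def Let_def)
qed

lemma min_recurrence_degree_F_poly:
  fixes b :: "'k::field params"
  assumes \<epsilon>: "\<epsilon> \<in> {1, -1}"
    and b: "par_t b \<noteq> 0" "par_v b \<noteq> 0" "par_v b ^ 2 \<noteq> 4 * par_p b ^ 2 * par_t b"
  shows "min_recurrence_degree (\<lambda>n. coeff (F_poly \<epsilon> b n) k) (6 * (k + 1))"
proof -
  define Q where "Q = Q_poly \<epsilon> b ^ (k + 1)"
  define s where "s = 1 - monom (par_t b) 2"
  define r where "r = 1 + monom (of_int \<epsilon> * par_t b) 2"
  define N where "N = [:0, 1:] ^ k * s ^ (k + 1) * r ^ k"
  have degQ: "degree Q = 6 * (k + 1)"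
    unfolding Q_def using coeff_0_Q_poly[of \<epsilon> b] degree_Q_poly[OF b(1), of \<epsilon>]
    by (subst degree_power_eq) auto
  have pow: "degree (f ^ n) \<le> m * n" if "degree f \<le> m" for f :: "'k poly" and m n
    by (rule order.trans[OF degree_power_le mult_right_mono[OF that]]) simp
  have "degree ([:0, 1 :: 'k:] ^ k) \<le> 1 * k"
    by (rule pow) simp
  moreover have "degree (s ^ (k + 1)) \<le> 2 * (k + 1)"
    unfolding s_def by (intro pow degree_diff_le degree_monom_le) simp
  moreover have "degree (r ^ k) \<le> 2 * k"
    unfolding r_def by (intro pow degree_add_le degree_monom_le) simp
  \<comment> \<open>The bound is 5k + 2, below 6(k + 1).\<close>
  ultimately have "degree N \<le> 1 * k + 2 * (k + 1) + 2 * k"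
    unfolding N_def by (intro order.trans[OF degree_mult_le] add_mono)
  hence degN: "degree N < degree Q"
    unfolding degQ by simp
  have fs: "fps_of_poly s = 1 - fps_const (par_t b) * fps_X ^ 2"
    and fr: "fps_of_poly r = 1 + fps_const (of_int \<epsilon> * par_t b) * fps_X ^ 2"
    by (simp_all add: s_def r_def fps_of_poly_simps fps_of_poly_monom)
  have fX: "fps_of_poly [:0, 1 :: 'k:] = fps_X"
    by (simp add: fps_of_poly_pCons)
  have gf: "Abs_fps (\<lambda>n. coeff (F_poly \<epsilon> b n) k) * fps_of_poly Q = fps_of_poly N"
    using F_fps_times_Q_power[OF \<epsilon>, of b k]
    unfolding F_fps_def Q_def N_def fps_of_poly_mult fps_of_poly_power fs fr fX .
  have "bezout_coprime (Q_poly \<epsilon> b) N"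
    unfolding N_def s_def r_def
    by (intro bezout_coprime_mult bezout_coprime_power Q_poly_bezout[OF \<epsilon> b])
  hence "bezout_coprime Q N"
    unfolding Q_def using bezout_coprime_power bezout_coprime_sym by blast
  moreover have "coeff Q 0 = 1"
    unfolding Q_def by (metis coeff_0_Q_poly poly_0_coeff_0 poly_power power_one)
  ultimately show ?thesis
    using min_recurrence_degree_rational[OF gf _ degN] degQ by simp
qed

section \<open>Zariski genericity\<close>

lemma eval4_simps:
  "eval4 (f * g) a = eval4 f a * eval4 g a"
  "eval4 (f - g) a = eval4 f a - eval4 g a" "eval4 (f ^ n) a = eval4 f a ^ n"
  "eval4 (numeral m) a = numeral m"
  by (cases a; simp add: numeral_poly)+

lemma eval4_nonzero: "eval4 f a \<noteq> 0 \<Longrightarrow> f \<noteq> 0"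
  by (cases a) auto

lemma zariski_open_nonzero: "zariski_open {a. eval4 f a \<noteq> 0}"
  unfolding zariski_open_def zariski_closed_def by (intro exI[of _ "{f}"]) auto

lemma generic_min_recurrence_degree:
  assumes \<epsilon>: "\<epsilon> \<in> {1, -1}"
  shows "\<exists>U :: 'k::field_char_0 params set. zariski_open U \<and> U \<noteq> {} \<and>
    (\<forall>b \<in> U. min_recurrence_degree (\<lambda>n. coeff (F_poly \<epsilon> b n) k) (6 * (k + 1)))"
proof -
  define w x y z :: "'k poly poly poly poly"
    where "w = [:[:[:[:0, 1:]:]:]:]" and "x = [:[:[:0, 1:]:]:]" and "y = [:[:0, 1:]:]" and "z = [:0, 1:]"
  define t v p where "t = w * z" and "v = w * y ^ 2 + x ^ 2 * z" and "p = x * y"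
  define f where "f = t * v * (v ^ 2 - 4 * p ^ 2 * t)"
  have "eval4 t b = par_t b" "eval4 v b = par_v b" "eval4 p b = par_p b" for b
    by (cases b; simp add: t_def v_def p_def w_def x_def y_def z_def)+
  hence f: "eval4 f b = par_t b * par_v b * (par_v b ^ 2 - 4 * par_p b ^ 2 * par_t b)" for b
    unfolding f_def eval4_simps by simp
  \<comment> \<open>At this point p = 0 and t = v = 1, so all three factors equal 1.\<close>
  have "eval4 f (1, 0, 1, 1) \<noteq> 0" unfolding f by simp
  hence "{b. eval4 f b \<noteq> 0} \<noteq> {}" by blast
  moreover have "min_recurrence_degree (\<lambda>n. coeff (F_poly \<epsilon> b n) k) (6 * (k + 1))"
    if "b \<in> {b. eval4 f b \<noteq> 0}" for b
    using that unfolding f by (intro min_recurrence_degree_F_poly[OF \<epsilon>]) auto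
  ultimately show ?thesis
    using zariski_open_nonzero[of f] by blast
qed

section \<open>The gcd over the field generated by p, t and v\<close>

lemma indets_generic:
  "par_t indets \<noteq> 0" "par_v indets \<noteq> 0" "par_v indets ^ 2 \<noteq> 4 * par_p indets ^ 2 * par_t indets"
proof -
  define w x y z :: "rat poly poly poly poly"
    where "w = [:[:[:[:0, 1:]:]:]:]" and "x = [:[:[:0, 1:]:]:]" and "y = [:[:0, 1:]:]" and "z = [:0, 1:]"
  have ind: "indets = (to_fract w, to_fract x, to_fract y, to_fract z)"
    by (simp add: indets_def w_def x_def y_def z_def)
  have par: "par_t indets = to_fract (w * z)" "par_v indets = to_fract (w * y ^ 2 + x ^ 2 * z)"
    by (simp_all add: ind power2_eq_square)
  \<comment> \<open>The point (2, 1, 1, 1) gives the values 2, 3 and 1.\<close>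
  have nz: "w * z \<noteq> 0" "w * y ^ 2 + x ^ 2 * z \<noteq> 0" "w * y ^ 2 - x ^ 2 * z \<noteq> 0"
    by (rule eval4_nonzero[of _ "(2, 1, 1, 1)"], simp add: w_def x_def y_def z_def)+
  show "par_t indets \<noteq> 0" "par_v indets \<noteq> 0"
    using nz(1,2) unfolding par by (simp_all only: to_fract_eq_0_iff not_False_eq_True)
  \<comment> \<open>The difference is a perfect square, so it suffices that its root is
    nonzero.\<close>
  have "par_v indets ^ 2 - 4 * par_p indets ^ 2 * par_t indets = to_fract (w * y ^ 2 - x ^ 2 * z) ^ 2"
    by (simp add: ind power2_eq_square algebra_simps)
  also have "\<dots> \<noteq> 0"
    using nz(3) by (intro power_not_zero) (simp only: to_fract_eq_0_iff not_False_eq_True)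
  finally show "par_v indets ^ 2 \<noteq> 4 * par_p indets ^ 2 * par_t indets" by auto
qed

lemma generated_subfield_closed:
  "S \<subseteq> generated_subfield S" "0 \<in> generated_subfield S" "1 \<in> generated_subfield S"
  "x \<in> generated_subfield S \<Longrightarrow> y \<in> generated_subfield S \<Longrightarrow> x + y \<in> generated_subfield S"
  "x \<in> generated_subfield S \<Longrightarrow> y \<in> generated_subfield S \<Longrightarrow> x * y \<in> generated_subfield S"
  "x \<in> generated_subfield S \<Longrightarrow> - x \<in> generated_subfield S"
  "x \<in> generated_subfield S \<Longrightarrow> inverse x \<in> generated_subfield S"
  unfolding generated_subfield_def by auto

lemma generated_subfield_sum:
  "(\<And>x. x \<in> A \<Longrightarrow> f x \<in> generated_subfield S) \<Longrightarrow> sum f A \<in> generated_subfield S"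
  by (induction A rule: infinite_finite_induct) (auto intro: generated_subfield_closed)

lemma polys_over_closed:
  fixes S :: "'a::field set"
  defines "K \<equiv> generated_subfield S"
  shows "0 \<in> polys_over K" "1 \<in> polys_over K"
    and "f \<in> polys_over K \<Longrightarrow> g \<in> polys_over K \<Longrightarrow> f + g \<in> polys_over K"
    and "f \<in> polys_over K \<Longrightarrow> g \<in> polys_over K \<Longrightarrow> f - g \<in> polys_over K"
    and "f \<in> polys_over K \<Longrightarrow> g \<in> polys_over K \<Longrightarrow> f * g \<in> polys_over K"
    and "c \<in> K \<Longrightarrow> monom c n \<in> polys_over K"
    and "c \<in> K \<Longrightarrow> f \<in> polys_over K \<Longrightarrow> pCons c f \<in> polys_over K"
proof -
  note closed = generated_subfield_closed[where S = S, folded K_def]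
  show "0 \<in> polys_over K" "1 \<in> polys_over K"
    by (simp_all add: polys_over_def closed)
  show "f \<in> polys_over K \<Longrightarrow> g \<in> polys_over K \<Longrightarrow> f + g \<in> polys_over K"
    by (simp add: polys_over_def closed)
  show "f \<in> polys_over K \<Longrightarrow> g \<in> polys_over K \<Longrightarrow> f - g \<in> polys_over K"
    unfolding diff_conv_add_uminus by (simp add: polys_over_def closed del: add_uminus_conv_diff)
  show "f \<in> polys_over K \<Longrightarrow> g \<in> polys_over K \<Longrightarrow> f * g \<in> polys_over K"
    by (simp add: polys_over_def coeff_mult K_def generated_subfield_sum generated_subfield_closed)
  show "c \<in> K \<Longrightarrow> monom c n \<in> polys_over K"
    by (simp add: polys_over_def closed)
  show "c \<in> K \<Longrightarrow> f \<in> polys_over K \<Longrightarrow> pCons c f \<in> polys_over K"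
    by (simp add: polys_over_def closed coeff_pCons split: nat.split)
qed

text \<open>The Bezout cofactors may have coefficients outside K: they only serve to force a common
  divisor to be a nonzero constant. This constant lies in K, and so does its inverse, so it divides
  1 over K.\<close>

lemma is_gcd_over_1:
  fixes S :: "'a::field set"
  defines "K \<equiv> generated_subfield S"
  assumes "f \<in> polys_over K" "g \<in> polys_over K" "bezout_coprime f g"
  shows "is_gcd_over K f g 1"
  unfolding is_gcd_over_def
proof (intro conjI allI impI)
  note over = polys_over_closed[where S = S, folded K_def]
  show "dvd_over K 1 f" "dvd_over K 1 g"
    using assms(2,3) over(2) by (auto simp: dvd_over_def)
  fix e assume e: "dvd_over K e f" "dvd_over K e g"
  hence "e dvd 1"
    by (intro bezout_coprime_dvd_1[OF assms(4)]) (auto simp: dvd_over_def)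
  then obtain c where c: "e = [:c:]" "c \<noteq> 0"
    by (auto elim!: is_unit_polyE simp: dvd_field_iff)
  have "coeff e 0 \<in> K" using e(1) by (auto simp: dvd_over_def polys_over_def)
  hence "inverse c \<in> K"
    using generated_subfield_closed(7)[of c S] unfolding c K_def by simp
  hence "[:inverse c:] \<in> polys_over K"
    by (intro over)
  moreover have "1 = e * [:inverse c:]" using c by (simp add: one_pCons)
  ultimately show "dvd_over K e 1"
    using e(1) over(2) unfolding dvd_over_def by blast
qed

lemma is_gcd_over_Q_poly:
  assumes \<epsilon>: "\<epsilon> \<in> {1, -1}"
    and a: "par_t a \<noteq> 0" "par_v a \<noteq> 0" "par_v a ^ 2 \<noteq> 4 * par_p a ^ 2 * par_t a"
  shows "is_gcd_over (generated_subfield {par_p a, par_t a, par_v a}) (Q_poly \<epsilon> a)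
    ([:0, 1:] * (1 - monom (par_t a) 2) * (1 + monom (of_int \<epsilon> * par_t a) 2)) 1"
proof (rule is_gcd_over_1)
  let ?S = "{par_p a, par_t a, par_v a}"
  note closed = generated_subfield_closed(2-)[where S = ?S]
  note over = polys_over_closed[where S = ?S]
  have par: "par_p a \<in> generated_subfield ?S" "par_t a \<in> generated_subfield ?S" "par_v a \<in> generated_subfield ?S"
    using generated_subfield_closed(1)[of ?S] by auto
  have e: "of_int \<epsilon> \<in> generated_subfield ?S" using \<epsilon> closed(2) closed(5)[OF closed(2)] by auto
  show "Q_poly \<epsilon> a \<in> polys_over (generated_subfield ?S)"
    unfolding Q_poly_def Let_def power3_eq_cube by (intro over closed par e)
  show "[:0, 1:] * (1 - monom (par_t a) 2) * (1 + monom (of_int \<epsilon> * par_t a) 2) \<in>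
      polys_over (generated_subfield ?S)"
    by (intro over closed par e)
  show "bezout_coprime (Q_poly \<epsilon> a)
      ([:0, 1:] * (1 - monom (par_t a) 2) * (1 + monom (of_int \<epsilon> * par_t a) 2))"
    by (intro bezout_coprime_mult Q_poly_bezout[OF \<epsilon> a])
qed

theorem corollary4p6:
  fixes a :: "'a::field params"
  shows
    "(\<forall>\<epsilon> \<in> {1, -1}. \<forall>k n.
        coeff (F_poly \<epsilon> a n) k =
        fps_coeff ((1 + fps_const (of_int \<epsilon> * par_t a) * fps_X ^ 2) ^ k * Z_fps \<epsilon> a ^ (k + 1))
          (int n - int k)) \<and>
     (\<forall>\<epsilon> \<in> {1, -1}. \<forall>k n.
        coeff (F_poly \<epsilon> a n) k =
        (\<Sum>j = 0..k. of_nat (k choose j) * (of_int \<epsilon> * par_t a) ^ j *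
          (\<Sum>r | r \<in> {0..k} \<rightarrow>\<^sub>E (UNIV :: nat set) \<and>
                 int (\<Sum>i = 0..k. r i) = int n - int k - 2 * int j.
             \<Prod>i = 0..k. Z_seq \<epsilon> a (r i)))) \<and>
     (\<forall>\<epsilon> \<in> {1, -1}. \<forall>k.
        Abs_fps (\<lambda>n. coeff (F_poly \<epsilon> a n) k) =
        fps_X ^ k * (1 - fps_const (par_t a) * fps_X ^ 2) ^ (k + 1) *
          (1 + fps_const (of_int \<epsilon> * par_t a) * fps_X ^ 2) ^ k /
        fps_of_poly (Q_poly \<epsilon> a) ^ (k + 1)) \<and>
     (\<forall>\<epsilon> \<in> {1, -1}.
        is_gcd_over (generated_subfield {par_p indets, par_t indets, par_v indets})
          (Q_poly \<epsilon> indets)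
          ([:0, 1:] * (1 - monom (par_t indets) 2) * (1 + monom (of_int \<epsilon> * par_t indets) 2)) 1) \<and>
     (\<forall>\<epsilon> \<in> {1, -1}. \<forall>k. \<exists>U :: 'k::field_char_0 params set.
        zariski_open U \<and> U \<noteq> {} \<and>
        (\<forall>b \<in> U. min_recurrence_degree (\<lambda>n. coeff (F_poly \<epsilon> b n) k) (6 * (k + 1))))"
proof (intro conjI ballI allI)
  fix \<epsilon> :: int and k n :: nat
  assume \<epsilon>: "\<epsilon> \<in> {1, -1}"
  define H where "H = (1 + fps_const (of_int \<epsilon> * par_t a) * fps_X ^ 2) ^ k * Z_fps \<epsilon> a ^ (k + 1)"
  have "coeff (F_poly \<epsilon> a n) k = F_fps \<epsilon> a k $ n" by (simp add: F_fps_def)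
  \<comment> \<open>The factor z^k shifts the coefficient; n < k gives zero on both sides.\<close>
  also have "\<dots> = fps_coeff H (int n - int k)"
    unfolding F_fps_eq[OF \<epsilon>] H_def[symmetric]
    by (auto simp: fps_coeff_def fps_X_power_mult_nth nat_diff_distrib)
  finally show *: "coeff (F_poly \<epsilon> a n) k = fps_coeff H (int n - int k)" unfolding H_def .
  show "coeff (F_poly \<epsilon> a n) k =
        (\<Sum>j = 0..k. of_nat (k choose j) * (of_int \<epsilon> * par_t a) ^ j *
          (\<Sum>r | r \<in> {0..k} \<rightarrow>\<^sub>E (UNIV :: nat set) \<and>
                 int (\<Sum>i = 0..k. r i) = int n - int k - 2 * int j.
             \<Prod>i = 0..k. Z_seq \<epsilon> a (r i)))"
    using * unfolding H_def fps_coeff_power_expand by (simp only: Z_fps_def fps_nth_Abs_fps)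
next
  fix \<epsilon> :: int and k :: nat
  assume \<epsilon>: "\<epsilon> \<in> {1, -1}"
  show "Abs_fps (\<lambda>n. coeff (F_poly \<epsilon> a n) k) =
        fps_X ^ k * (1 - fps_const (par_t a) * fps_X ^ 2) ^ (k + 1) *
          (1 + fps_const (of_int \<epsilon> * par_t a) * fps_X ^ 2) ^ k /
        fps_of_poly (Q_poly \<epsilon> a) ^ (k + 1)"
    \<comment> \<open>The numerator is rewritten as the series times Q^(k+1), which then
      cancels.\<close>
    unfolding F_fps_times_Q_power[OF \<epsilon>, symmetric] F_fps_def[symmetric]
    by (rule nonzero_mult_div_cancel_right[symmetric]) (simp add: fps_of_Q_poly_nz)
next
  fix \<epsilon> :: int
  assume "\<epsilon> \<in> {1, -1}"
  thus "is_gcd_over (generated_subfield {par_p indets, par_t indets, par_v indets})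
          (Q_poly \<epsilon> indets)
          ([:0, 1:] * (1 - monom (par_t indets) 2) * (1 + monom (of_int \<epsilon> * par_t indets) 2)) 1"
    by (intro is_gcd_over_Q_poly indets_generic)
next
  fix \<epsilon> :: int and k :: nat
  assume "\<epsilon> \<in> {1, -1}"
  thus "\<exists>U :: 'k params set. zariski_open U \<and> U \<noteq> {} \<and>
        (\<forall>b \<in> U. min_recurrence_degree (\<lambda>n. coeff (F_poly \<epsilon> b n) k) (6 * (k + 1)))"
    by (rule generic_min_recurrence_degree)
qed

end
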